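(* Let $q$ and $q+2$ be prime powers with $q\equiv3\pmod 4$, and let $E$ be a skew Hadamard difference set in $(\mathbb{F}_q,+)$. Let $\chi$ be the quadratic character of $\mathbb{F}_{q+2}^*$. Then the set $$D=\{(x,y)\mid x\in E,\ y\in\mathbb{F}_{q+2}^*,\ \chi(y)=1\}\cup\{(x,y)\mid x\in -E,\ y\in\mathbb{F}_{q+2}^*,\ \chi(y)=-1\}\cup\{(x,0)\mid x\in\mathbb{F}_q\}$$ is a $(4n-1,2n-1,n-1)$ difference set in $(\mathbb{F}_q,+)\times(\mathbb{F}_{q+2},+)$, where $n=\frac{(q+1)^2}{4}$.
   Context: A $k$-subset $D$ of a finite abelian group $G$ (written additively) of order $v$ is a $(v,k,\lambda)$ difference set if every nonzero element of $G$ is represented exactly $\lambda$ times as $x-y$ with $x,y\in D$, $x\ne y$. A difference set $E$ in $(\mathbb{F}_q,+)$ is skew Hadamard if $\mathbb{F}_q$ is the disjoint union of $E$, $-E$ and $\{0\}$. *)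

theory Defs
  imports "HOL-Library.Cardinality" "HOL-Library.Product_Plus"
    "HOL-Number_Theory.Cong" "HOL-Number_Theory.Prime_Powers"
begin

definition difference_set ::
    "'g::{ab_group_add, finite} set \<Rightarrow> nat \<Rightarrow> nat \<Rightarrow> nat \<Rightarrow> bool" where
  "difference_set D v k l \<longleftrightarrow>
     CARD('g) = v \<and> card D = k \<and>
     (\<forall>g. g \<noteq> 0 \<longrightarrow> card {(x, y). x \<in> D \<and> y \<in> D \<and> x \<noteq> y \<and> x - y = g} = l)"

definition skew_hadamard_difference_set :: "'a::{field, finite} set \<Rightarrow> bool" where
  "skew_hadamard_difference_set E \<longleftrightarrow>
     (\<exists>v k l. difference_set E v k l) \<and>
     E \<union> uminus ` E \<union> {0} = UNIV \<and>
     E \<inter> uminus ` E = {} \<and> 0 \<notin> E \<and> 0 \<notin> uminus ` E"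

text \<open>The quadratic character is a character of the multiplicative group; the value at
  0 is only the customary extension.\<close>

definition quadratic_character :: "'b::field \<Rightarrow> int" where
  "quadratic_character y =
     (if y = 0 then 0 else if \<exists>z. y = z\<^sup>2 then 1 else - 1)"

end

theory Submission
  imports Defs
begin

text \<open>
  Let \<open>s\<close> be the function that is 1 on \<open>E\<close>, -1 on \<open>-E\<close> and 0 at 0. A function with mean zero
  whose autocorrelation is constant off 0 and equal to \<open>v - 1\<close> at 0 has autocorrelation -1
  off 0; this applies to \<open>s\<close> because \<open>E\<close> is a difference set, and to \<open>\<chi>\<close> because
  multiplication by \<open>h\<close> carries shift 1 to shift \<open>h\<close>. The \<open>\<plusminus>1\<close>-indicator of \<open>D\<close> is
  \<open>s \<otimes> \<chi> + 1 \<otimes> \<delta> + \<delta> \<otimes> (\<delta> - 1)\<close>, and correlations of tensor products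
  factorise. The only terms that do not depend on \<open>g = 0\<close> and \<open>h = 0\<close> alone add up to
  \<open>s(g) \<chi>(h) + s(-g) \<chi>(-h)\<close>, which vanishes since \<open>s\<close> is odd and, as
  \<open>q + 2 \<equiv> 1 (mod 4)\<close>, \<open>\<chi>\<close> is even.
\<close>

section \<open>Correlations\<close>

text \<open>Periodic cross-correlation. The shift sits in the first argument, so for the indicator
  of a set the value at \<open>g\<close> counts the pairs with difference \<open>g\<close>.\<close>

definition corr :: "('g::{ab_group_add, finite} \<Rightarrow> int) \<Rightarrow> ('g \<Rightarrow> int) \<Rightarrow> 'g \<Rightarrow> int" where
  "corr f f' g = (\<Sum>x\<in>UNIV. f (x + g) * f' x)"

definition delta :: "'g::zero \<Rightarrow> int" where
  "delta x = of_bool (x = 0)"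

lemma sum_translate:
  fixes f :: "'g::{ab_group_add, finite} \<Rightarrow> int"
  shows "(\<Sum>x\<in>UNIV. f (x + g)) = sum f UNIV"
  by (rule sum.reindex_bij_witness[of _ "\<lambda>x. x - g" "\<lambda>x. x + g"]) auto

lemma sum_uminus:
  fixes f :: "'g::{ab_group_add, finite} \<Rightarrow> int"
  shows "(\<Sum>x\<in>UNIV. f (- x)) = sum f UNIV"
  by (rule sum.reindex_bij_witness[of _ uminus uminus]) auto

lemma corr_add_left: "corr (\<lambda>x. f x + f' x) k g = corr f k g + corr f' k g"
  and corr_add_right: "corr k (\<lambda>x. f x + f' x) g = corr k f g + corr k f' g"
  and corr_diff_left: "corr (\<lambda>x. f x - f' x) k g = corr f k g - corr f' k g"
  and corr_diff_right: "corr k (\<lambda>x. f x - f' x) g = corr k f g - corr k f' g"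
  by (simp_all add: corr_def algebra_simps sum.distrib sum_subtractf)

lemma corr_scale_left: "corr (\<lambda>x. c * f x) k g = c * corr f k g"
  and corr_scale_right: "corr k (\<lambda>x. c * f x) g = c * corr k f g"
  by (simp_all add: corr_def sum_distrib_left mult_ac)

lemma corr_const_left: "corr (\<lambda>x. c) k g = c * sum k UNIV"
  by (simp add: corr_def sum_distrib_left)

lemma corr_const_right: "corr k (\<lambda>x. c) g = c * sum k UNIV"
  by (simp add: corr_def sum_translate mult.commute flip: sum_distrib_left)

lemma corr_delta_right: "corr k delta g = k g"
proof -
  have "corr k delta g = (\<Sum>x\<in>UNIV. if x = 0 then k (x + g) else 0)"
    unfolding corr_def delta_def by (rule sum.cong) auto
  then show ?thesis by simp
qed

lemma corr_delta_left: "corr delta k g = k (- g)"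
proof -
  have "corr delta k g = (\<Sum>x\<in>UNIV. if x = - g then k x else 0)"
    unfolding corr_def delta_def by (rule sum.cong) (auto simp: eq_neg_iff_add_eq_0)
  then show ?thesis by simp
qed

lemma sum_delta_UNIV: "sum delta (UNIV :: 'g::{zero, finite} set) = 1"
proof -
  have "sum delta (UNIV :: 'g set) = (\<Sum>x::'g\<in>UNIV. if x = 0 then 1 else 0)"
    unfolding delta_def by (rule sum.cong) auto
  then show ?thesis by simp
qed

definition tensor :: "('g \<Rightarrow> int) \<Rightarrow> ('h \<Rightarrow> int) \<Rightarrow> 'g \<times> 'h \<Rightarrow> int" where
  "tensor a b z = a (fst z) * b (snd z)"

lemma sum_tensor:
  fixes a :: "'g::finite \<Rightarrow> int" and b :: "'h::finite \<Rightarrow> int"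
  shows "sum (tensor a b) UNIV = sum a UNIV * sum b UNIV"
  by (simp add: tensor_def[abs_def] sum_product sum.cartesian_product case_prod_unfold)

lemma corr_tensor: "corr (tensor a b) (tensor c d) (g, h) = corr a c g * corr b d h"
proof -
  have "corr (tensor a b) (tensor c d) (g, h) =
      sum (tensor (\<lambda>x. a (x + g) * c x) (\<lambda>y. b (y + h) * d y)) UNIV"
    by (simp add: corr_def tensor_def[abs_def] mult_ac)
  then show ?thesis by (simp add: sum_tensor corr_def)
qed

text \<open>For fixed \<open>x\<close> the points \<open>x + g\<close> run through the whole group,
  so exchanging the two sums separates the factors.\<close>

lemma sum_corr: "(\<Sum>g\<in>UNIV. corr f f' g) = sum f UNIV * sum f' UNIV"
proof -
  have "(\<Sum>g\<in>UNIV. corr f f' g) = (\<Sum>x\<in>UNIV. \<Sum>g\<in>UNIV. f (x + g) * f' x)"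
    unfolding corr_def by (rule sum.swap)
  also have "\<dots> = (\<Sum>x\<in>UNIV. sum f UNIV * f' x)"
    using sum_translate[of f] by (simp add: add.commute flip: sum_distrib_right)
  finally show ?thesis by (simp flip: sum_distrib_left)
qed

text \<open>The correlations add up to the square of the sum of \<open>f\<close>, which is 0. With v
  the group order this reads (v - 1) + (v - 1) c = 0, and v > 1 lets v - 1 be cancelled.\<close>

lemma corr_eq_minus_one:
  fixes f :: "'g::{ab_group_add, finite} \<Rightarrow> int"
  assumes "sum f UNIV = 0" and "corr f f 0 = int CARD('g) - 1"
    and const: "\<And>g. g \<noteq> 0 \<Longrightarrow> corr f f g = c" and "CARD('g) > 1" and "g \<noteq> 0"
  shows "corr f f g = - 1"
proof -
  have "0 = (\<Sum>g\<in>UNIV. corr f f g)" by (simp add: sum_corr assms)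
  also have "\<dots> = corr f f 0 + (\<Sum>g\<in>UNIV - {0}. corr f f g)"
    by (rule sum.remove) auto
  also have "(\<Sum>g\<in>UNIV - {0}. corr f f g) = (\<Sum>g\<in>UNIV - {0::'g}. c)"
    by (rule sum.cong) (auto simp: const)
  also have "\<dots> = (int CARD('g) - 1) * c"
    using assms(4) by (simp add: of_nat_diff)
  finally have "(int CARD('g) - 1) * (c + 1) = 0"
    unfolding assms(2) by algebra
  with assms show ?thesis by auto
qed

text \<open>A pair with difference \<open>g\<close> is determined by its second entry; its entries
  are distinct because \<open>g\<close> is nonzero.\<close>

lemma card_differences:
  fixes D :: "'g::{ab_group_add, finite} set"
  assumes "g \<noteq> 0"
  shows "int (card {(x, y). x \<in> D \<and> y \<in> D \<and> x \<noteq> y \<and> x - y = g}) =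
    corr (\<lambda>x. of_bool (x \<in> D)) (\<lambda>x. of_bool (x \<in> D)) g"
proof -
  have "card {(x, y). x \<in> D \<and> y \<in> D \<and> x \<noteq> y \<and> x - y = g} = card {x. x + g \<in> D \<and> x \<in> D}"
    by (rule bij_betw_same_card[OF bij_betw_byWitness[of _ "\<lambda>x. (x + g, x)" snd]])
      (use assms in \<open>auto simp: algebra_simps\<close>)
  also have "int \<dots> = (\<Sum>x\<in>{x. x + g \<in> D \<and> x \<in> D}. 1)" by simp
  also have "\<dots> = (\<Sum>x\<in>UNIV. of_bool (x + g \<in> D) * of_bool (x \<in> D))"
    by (rule sum.mono_neutral_cong_left) auto
  finally show ?thesis by (simp add: corr_def)
qed

lemma sum_of_bool_mem:
  "(\<Sum>x\<in>UNIV. of_bool (x \<in> D)) = int (card (D :: 'g::finite set))"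
proof -
  have "(\<Sum>x\<in>UNIV. of_bool (x \<in> D)) = (\<Sum>x\<in>D. (1::int))"
    by (rule sum.mono_neutral_cong_right) auto
  then show ?thesis by simp
qed

lemma difference_setI_corr:
  fixes D :: "'g::{ab_group_add, finite} set"
  assumes f: "\<And>x. f x = (if x \<in> D then 1 else - 1)"
    and "sum f UNIV = - 1" and "\<And>g. g \<noteq> 0 \<Longrightarrow> corr f f g = - 1"
    and "CARD('g) = 4 * n - 1" and "n > 0"
  shows "difference_set D (4 * n - 1) (2 * n - 1) (n - 1)"
proof -
  have f': "f = (\<lambda>x. 2 * of_bool (x \<in> D) - 1)" by (auto simp: f)
  have k: "2 * int (card D) - int CARD('g) = - 1"
    using assms(2) by (simp add: f' sum_subtractf sum_of_bool_mem flip: sum_distrib_left)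
  have "card {(x, y). x \<in> D \<and> y \<in> D \<and> x \<noteq> y \<and> x - y = g} = n - 1" if "g \<noteq> 0" for g
  proof -
    let ?i = "\<lambda>x. of_bool (x \<in> D) :: int"
    \<comment> \<open>Expanding \<open>f\<close> as twice the indicator minus 1 gives -1 = 4
      \<lambda> - 4 k + v. With v = 4n - 1 and k = 2n - 1 this forces \<lambda> = n - 1;
      \<open>n > 0\<close> keeps the natural subtractions exact.\<close>
    have "- 1 = 4 * corr ?i ?i g - 4 * int (card D) + int CARD('g)"
      unfolding assms(3)[OF that, symmetric] f'
      by (simp add: corr_scale_left corr_scale_right corr_diff_left corr_diff_right
          corr_const_left corr_const_right sum_of_bool_mem flip: sum_distrib_left)
    with k assms(4,5) show ?thesis
      using card_differences[OF that, of D] by linarith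
  qed
  then show ?thesis using k assms(4,5) by (auto simp: difference_set_def)
qed

section \<open>Skew Hadamard difference sets\<close>

text \<open>For a skew Hadamard \<open>E\<close> the last branch is exactly -E.\<close>

definition skew_sign :: "'a::{field, finite} set \<Rightarrow> 'a \<Rightarrow> int" where
  "skew_sign E x = (if x \<in> E then 1 else if x = 0 then 0 else - 1)"

context
  fixes E :: "'a::{field, finite} set"
  assumes E: "skew_hadamard_difference_set E"
begin

text \<open>Packs the partition into one rewrite rule; its instance at 0 yields
  \<open>0 \<notin> E\<close>.\<close>

lemma uminus_mem_skew_iff: "- x \<in> E \<longleftrightarrow> x \<noteq> 0 \<and> x \<notin> E"
proof -
  have cover: "E \<union> uminus ` E \<union> {0} = UNIV" and disj: "E \<inter> uminus ` E = {}" "0 \<notin> E"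
    using E by (auto simp: skew_hadamard_difference_set_def)
  have "x \<in> uminus ` E \<longleftrightarrow> - x \<in> E" by (metis image_iff minus_minus)
  then show ?thesis using cover disj by auto
qed

lemma skew_sign_uminus: "skew_sign E (- x) = - skew_sign E x"
  using uminus_mem_skew_iff[of x] uminus_mem_skew_iff[of 0] by (auto simp: skew_sign_def)

lemma sum_skew_sign: "sum (skew_sign E) UNIV = 0"
  using sum_uminus[of "skew_sign E"] by (simp add: skew_sign_uminus sum_negf)

lemma corr_skew_sign:
  "corr (skew_sign E) (skew_sign E) g = (if g = 0 then int CARD('a) - 1 else - 1)"
proof -
  let ?i = "\<lambda>x. of_bool (x \<in> E) :: int"
  obtain v k l where ds: "difference_set E v k l"
    using E by (auto simp: skew_hadamard_difference_set_def)
  have 0: "corr (skew_sign E) (skew_sign E) 0 = int CARD('a) - 1"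
  proof -
    have "corr (skew_sign E) (skew_sign E) 0 = (\<Sum>x::'a\<in>UNIV. 1 - delta x)"
      unfolding corr_def delta_def
      by (rule sum.cong) (use uminus_mem_skew_iff[of 0] in \<open>auto simp: skew_sign_def\<close>)
    then show ?thesis by (simp add: sum_subtractf sum_delta_UNIV)
  qed
  \<comment> \<open>The parameters \<open>k\<close> and \<open>l\<close> stay unknown: it suffices
    that this value is the same for every nonzero \<open>g\<close>, since the zero sum then forces
    it to be -1.\<close>
  have c: "corr (skew_sign E) (skew_sign E) g = 4 * int l - 4 * int k + int CARD('a)"
    if g: "g \<noteq> 0" for g
  proof -
    have s: "skew_sign E = (\<lambda>x. 2 * ?i x - 1 + delta x)"
      using uminus_mem_skew_iff[of 0] by (auto simp: skew_sign_def delta_def fun_eq_iff)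
    have "corr ?i ?i g = int l"
      using ds card_differences[OF g, of E] g by (simp add: difference_set_def)
    \<comment> \<open>Exactly one of \<open>g\<close> and \<open>- g\<close> lies in
      \<open>E\<close>. So the cross terms between the indicator and \<open>delta\<close> contribute
      2, cancelling the -2 from \<open>delta\<close> against the constant -1.\<close>
    moreover have "?i g + ?i (- g) = 1"
      using uminus_mem_skew_iff[of g] g by simp
    moreover have "card E = k" using ds by (simp add: difference_set_def)
    ultimately show ?thesis
      unfolding s using g
      by (simp add: corr_scale_left corr_scale_right corr_add_left corr_add_right corr_diff_left
          corr_diff_right corr_const_left corr_const_right corr_delta_left corr_delta_right
          sum_of_bool_mem sum_delta_UNIV delta_def[of g] delta_def[of "- g"] flip: sum_distrib_left)
  qed
  have "CARD('a) > 1" using card_mono[of UNIV "{0, 1 :: 'a}"] by simp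
  then show ?thesis
    using 0 corr_eq_minus_one[OF sum_skew_sign 0 c] by simp
qed

end

section \<open>The quadratic character\<close>

text \<open>A fixed-point-free involution splits \<open>A\<close> into pairs; the induction removes
  one pair at a time.\<close>

lemma even_card_involution:
  assumes "finite A" and "\<And>x. x \<in> A \<Longrightarrow> f x \<in> A" and "\<And>x. x \<in> A \<Longrightarrow> f (f x) = x"
    and "\<And>x. x \<in> A \<Longrightarrow> f x \<noteq> x"
  shows "even (card A)"
  using assms
proof (induction A rule: finite_psubset_induct)
  case (psubset A)
  show ?case
  proof (cases "A = {}")
    case False
    then obtain x where x: "x \<in> A" by blast
    have fx: "f x \<in> A" "f x \<noteq> x" "f (f x) = x" using psubset.prems x by auto
    have "f y \<in> A - {x, f x}" if "y \<in> A - {x, f x}" for y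
      using that psubset.prems fx x by (metis Diff_iff insert_iff empty_iff)
    then have "even (card (A - {x, f x}))"
      using x by (intro psubset.IH) (auto simp: psubset.prems)
    moreover have "card A = card (A - {x, f x}) + 2"
      using x fx psubset.hyps card_Diff_subset[of "{x, f x}" A] card_mono[of A "{x, f x}"]
      by auto
    ultimately show ?thesis by simp
  qed simp
qed

definition squares :: "'b::field set" where
  "squares = {y. y \<noteq> 0 \<and> (\<exists>z. y = z\<^sup>2)}"

context
  assumes odd_card: "odd CARD('b::{field, finite})"
begin

lemma two_neq_zero_of_odd_card: "(2::'b) \<noteq> 0"
proof
  assume 2: "(2::'b) = 0"
  have "x + 1 + 1 = x" for x :: 'b
    using 2 by (metis add.assoc add.right_neutral one_add_one)
  \<comment> \<open>In characteristic 2 the translation by 1 is a fixed-point-free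
    involution.\<close>
  then have "even CARD('b)"
    by (intro even_card_involution[of _ "\<lambda>x. x + 1"]) auto
  with odd_card show False by simp
qed

lemma uminus_neq_self: "x \<noteq> 0 \<Longrightarrow> - x \<noteq> (x::'b)"
  using two_neq_zero_of_odd_card
  by (metis add.left_inverse mult_2 mult_eq_0_iff)

text \<open>Squaring is two-to-one on the nonzero elements, with fibres
  \<open>{z, - z}\<close>.\<close>

lemma card_squares: "2 * card (squares :: 'b set) + 1 = CARD('b)"
proof -
  have fib: "card {z \<in> UNIV - {0}. z\<^sup>2 = y} = 2" if y: "y \<in> squares" for y :: 'b
  proof -
    obtain z where z: "y = z\<^sup>2" using y unfolding squares_def by blast
    then have "z \<noteq> 0" using y by (auto simp: squares_def)
    have "{z \<in> UNIV - {0}. z\<^sup>2 = y} = {z, - z}"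
      using z \<open>z \<noteq> 0\<close> by (auto simp: power2_eq_iff)
    then show ?thesis using uminus_neq_self[OF \<open>z \<noteq> 0\<close>] by auto
  qed
  have "card (UNIV - {0::'b}) = (\<Sum>y::'b\<in>squares. card {z \<in> UNIV - {0::'b}. z\<^sup>2 = y})"
  proof -
    have "(\<lambda>z. z\<^sup>2) ` (UNIV - {0::'b}) = squares"
      by (auto simp: squares_def)
    then show ?thesis
      using sum.image_gen[of "UNIV - {0::'b}" "\<lambda>_. 1::nat" "\<lambda>z. z\<^sup>2"] by simp
  qed
  also have "\<dots> = 2 * card (squares :: 'b set)" using fib by simp
  finally have "card (UNIV - {0::'b}) = 2 * card (squares :: 'b set)" .
  moreover have "card (UNIV - {0::'b}) + 1 = CARD('b)"
    using card_Suc_Diff1[of UNIV "0::'b"] by simp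
  ultimately show ?thesis by simp
qed

text \<open>The coset of \<open>a\<close> misses the squares and has as many elements as there are
  nonzero nonsquares, so the inclusion is an equality.\<close>

lemma nonsquare_mult_squares:
  fixes a :: 'b
  assumes "a \<noteq> 0" "a \<notin> squares"
  shows "(*) a ` squares = UNIV - {0} - squares"
proof (rule card_subset_eq)
  have "a * y \<notin> squares" if y: "y \<in> squares" for y
  proof
    assume "a * y \<in> squares"
    then obtain z w where zw: "a * y = z\<^sup>2" "y = w\<^sup>2"
      using y unfolding squares_def by blast
    moreover have "w \<noteq> 0" using zw y by (auto simp: squares_def)
    ultimately have "a = (z / w)\<^sup>2" by (simp add: power_divide field_simps)
    with assms show False by (auto simp: squares_def)
  qed
  then show "(*) a ` squares \<subseteq> UNIV - {0} - squares"
    using assms by (auto simp: squares_def)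
  have "card (UNIV - {0} - (squares :: 'b set)) = CARD('b) - 1 - card (squares :: 'b set)"
    by (subst card_Diff_subset) (auto simp: squares_def)
  also have "\<dots> = card (squares :: 'b set)" using card_squares by linarith
  also have "card (squares :: 'b set) = card ((*) a ` squares)"
    using assms by (subst card_image) (auto simp: inj_on_def)
  finally show "card ((*) a ` squares) = card (UNIV - {0} - (squares :: 'b set))"
    by (rule sym)
qed simp

lemma squares_mult_iff:
  fixes a y :: 'b
  assumes "a \<noteq> 0" "y \<noteq> 0"
  shows "a * y \<in> squares \<longleftrightarrow> (a \<in> squares \<longleftrightarrow> y \<in> squares)"
proof -
  have closed: "u * v \<in> squares" if "u \<in> squares" "v \<in> squares" for u v :: 'b
    using that unfolding squares_def by (auto simp flip: power_mult_distrib)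
  have mixed: "u * v \<notin> squares" if "u \<notin> squares" "u \<noteq> 0" "v \<in> squares" for u v :: 'b
    using nonsquare_mult_squares[OF that(2,1)] that(3) by blast
  \<comment> \<open>A nonsquare product would lie in the coset of \<open>a\<close>, and cancelling
    \<open>a\<close> would make \<open>y\<close> a square.\<close>
  have non: "a * y \<in> squares" if "a \<notin> squares" "y \<notin> squares"
  proof (rule ccontr)
    assume "a * y \<notin> squares"
    then have "a * y \<in> (*) a ` squares"
      using nonsquare_mult_squares[OF assms(1) that(1)] assms by auto
    with that assms show False by auto
  qed
  show ?thesis
    using closed[of a y] mixed[of a y] mixed[of y a] non assms by (auto simp: mult.commute)
qed

lemma quadratic_character_eq:
  "quadratic_character (y::'b) = (if y = 0 then 0 else if y \<in> squares then 1 else - 1)"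
  by (simp add: quadratic_character_def squares_def)

lemma quadratic_character_mult:
  "quadratic_character (a * y :: 'b) = quadratic_character a * quadratic_character y"
  using squares_mult_iff[of a y] by (simp add: quadratic_character_eq)

lemma sum_quadratic_character: "sum quadratic_character (UNIV :: 'b set) = 0"
proof -
  have "sum quadratic_character (UNIV :: 'b set) =
      (\<Sum>y::'b\<in>UNIV. 2 * of_bool (y \<in> squares) - 1 + delta y)"
    by (rule sum.cong) (auto simp: quadratic_character_eq delta_def squares_def)
  also have "\<dots> = 2 * int (card (squares :: 'b set)) - int CARD('b) + 1"
    by (simp add: sum.distrib sum_subtractf sum_of_bool_mem sum_delta_UNIV
        flip: sum_distrib_left)
  finally show ?thesis using card_squares by linarith
qed

lemma corr_quadratic_character:
  "corr quadratic_character quadratic_character (h::'b) =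
    (if h = 0 then int CARD('b) - 1 else - 1)"
proof -
  let ?\<chi> = "quadratic_character :: 'b \<Rightarrow> int"
  have "corr ?\<chi> ?\<chi> 0 = (\<Sum>x::'b\<in>UNIV. 1 - delta x)"
    unfolding corr_def delta_def by (rule sum.cong) (auto simp: quadratic_character_def)
  then have 0: "corr ?\<chi> ?\<chi> 0 = int CARD('b) - 1"
    by (simp add: sum_subtractf sum_delta_UNIV)
  \<comment> \<open>Substituting \<open>h * y\<close> for the summation variable pulls out the
    square of \<open>?\<chi> h\<close>, which is 1.\<close>
  have c: "corr ?\<chi> ?\<chi> h = corr ?\<chi> ?\<chi> 1" if "h \<noteq> 0" for h
  proof -
    have "?\<chi> h * ?\<chi> h = 1" using that by (simp add: quadratic_character_def)
    then have "?\<chi> (h * y + h) * ?\<chi> (h * y) = ?\<chi> (y + 1) * ?\<chi> y" for y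
      using quadratic_character_mult[of h "y + 1"] quadratic_character_mult[of h y]
      by (simp add: algebra_simps)
    moreover have "corr ?\<chi> ?\<chi> h = (\<Sum>y\<in>UNIV. ?\<chi> (h * y + h) * ?\<chi> (h * y))"
      unfolding corr_def
      by (rule sum.reindex_bij_witness[of _ "\<lambda>y. h * y" "\<lambda>y. y / h"]) (use that in auto)
    ultimately show ?thesis by (simp add: corr_def)
  qed
  have "CARD('b) > 1" using card_mono[of UNIV "{0, 1 :: 'b}"] by simp
  then show ?thesis
    using 0 corr_eq_minus_one[OF sum_quadratic_character 0 c] by simp
qed

text \<open>If -1 were a nonsquare, then 1 would be the only fixed point of inversion on the
  nonzero squares, whose number is even.\<close>

lemma quadratic_character_uminus:
  assumes "CARD('b) mod 4 = 1"
  shows "quadratic_character (- y :: 'b) = quadratic_character y"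
proof -
  have one: "(1::'b) \<in> squares" by (auto simp: squares_def intro: exI[of _ 1])
  have "(- 1 :: 'b) \<in> squares"
  proof (rule ccontr)
    assume m: "(- 1 :: 'b) \<notin> squares"
    have "even (card (squares - {1 :: 'b}))"
    proof (rule even_card_involution[of _ inverse])
      fix x :: 'b assume x: "x \<in> squares - {1}"
      then obtain z where "x = z\<^sup>2" and "x \<noteq> 0" unfolding squares_def by blast
      then have "inverse x = (inverse z)\<^sup>2" by (simp add: power_inverse)
      with x \<open>x \<noteq> 0\<close> show "inverse x \<in> squares - {1}"
        unfolding squares_def by (auto intro: exI[of _ "inverse z"])
      show "inverse x \<noteq> x"
      proof
        assume "inverse x = x"
        then have "x\<^sup>2 = 1"
          using left_inverse[OF \<open>x \<noteq> 0\<close>] by (simp add: power2_eq_square)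
        with x m show False by (auto simp: power2_eq_1_iff)
      qed
    qed auto
    moreover have "card (squares :: 'b set) = card (squares - {1 :: 'b}) + 1"
      using one card_Suc_Diff1[of squares "1 :: 'b"] by simp
    ultimately have "odd (card (squares :: 'b set))" by simp
    \<comment> \<open>The field order is 1 mod 4 and equals twice the number of nonzero squares plus
      1, so that number must be even.\<close>
    with card_squares assms show False by presburger
  qed
  then have "quadratic_character (- 1 :: 'b) = 1" by (simp add: quadratic_character_eq)
  then show ?thesis using quadratic_character_mult[of "- 1" y] by simp
qed

end

section \<open>The twin prime power construction\<close>

theorem theorem5p2:
  fixes E :: "'a::{field, finite} set"
    and \<chi> :: "'b::{field, finite} \<Rightarrow> int"
    and D :: "('a \<times> 'b) set"
    and q n :: nat
  assumes "primepow q" and "primepow (q + 2)"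
    and "[q = 3] (mod 4)"
    and "CARD('a) = q" and "CARD('b) = q + 2"
    and "skew_hadamard_difference_set E"
    and "\<chi> = quadratic_character"
    and "D = {(x, y). x \<in> E \<and> y \<noteq> 0 \<and> \<chi> y = 1}
           \<union> {(x, y). x \<in> uminus ` E \<and> y \<noteq> 0 \<and> \<chi> y = - 1}
           \<union> {(x, y). y = 0}"
    and "n = (q + 1)\<^sup>2 div 4"
  shows "difference_set D (4 * n - 1) (2 * n - 1) (n - 1)"
proof -
  note E = assms(6)
  have mod: "q mod 4 = 3" using assms(3) by (simp add: cong_def)
  have odd: "odd CARD('b)" and mod_b: "CARD('b) mod 4 = 1"
    unfolding assms(5) using mod by presburger+
  obtain m where q: "q = 4 * m + 3" using mod by (metis mult_div_mod_eq)
  have n: "n = 4 * (m + 1)\<^sup>2"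
    by (simp add: assms(9) q power2_eq_square algebra_simps)
  let ?s = "skew_sign E"
  \<comment> \<open>The first term vanishes on both axes. The second puts 1 on the line y = 0, and
    the third puts -1 at the points (0, y) with y nonzero, which lie outside
    \<open>D\<close>.\<close>
  let ?f = "\<lambda>z. tensor ?s \<chi> z + tensor (\<lambda>_. 1) delta z + tensor delta (\<lambda>y. delta y - 1) z"
  have f: "?f z = (if z \<in> D then 1 else - 1)" for z
  proof -
    obtain x y where z: "z = (x, y)" by (cases z)
    have "x \<in> uminus ` E \<longleftrightarrow> - x \<in> E" by (metis image_iff minus_minus)
    then show ?thesis
      using uminus_mem_skew_iff[OF E, of x] uminus_mem_skew_iff[OF E, of 0]
      by (auto simp: z assms(7,8) tensor_def skew_sign_def delta_def quadratic_character_def)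
  qed
  \<comment> \<open>The three terms contribute 0, q and 1 - (q + 2).\<close>
  have sum: "sum ?f UNIV = - 1"
    by (simp add: sum_tensor sum.distrib sum_skew_sign[OF E] sum_subtractf sum_delta_UNIV
        assms(4,5))
  have corr: "corr ?f ?f z = - 1" if "z \<noteq> 0" for z
  proof -
    obtain g h where z: "z = (g, h)" by (cases z)
    have "\<chi> (- h) = \<chi> h"
      using quadratic_character_uminus[OF odd mod_b] by (simp add: assms(7))
    \<comment> \<open>Once the mixed terms in \<open>?s\<close> and \<open>\<chi>\<close> cancel,
      the value is (q \<delta>(g) - 1)((q + 2) \<delta>(h) - 1) + (q + 2) \<delta>(h) - 2 +
      \<delta>(g)(\<delta>(h) + q), where \<delta> is \<open>delta\<close>. It equals -1 in each of
      the three cases with (g, h) nonzero.\<close>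
    then show ?thesis
      using that
      by (simp add: z corr_add_left corr_add_right corr_tensor corr_diff_left corr_diff_right
          corr_const_left corr_const_right corr_delta_left corr_delta_right sum_delta_UNIV
          sum_subtractf corr_skew_sign[OF E] sum_skew_sign[OF E] skew_sign_uminus[OF E]
          assms(4,5,7) sum_quadratic_character[OF odd] corr_quadratic_character[OF odd])
        (auto simp: delta_def zero_prod_def)
  qed
  \<comment> \<open>Here q (q + 2) = (q + 1)^2 - 1, and 4 divides (q + 1)^2, so the division
    defining \<open>n\<close> is exact.\<close>
  have "CARD('a \<times> 'b) = 4 * n - 1"
    by (simp add: assms(4,5) q n power2_eq_square algebra_simps)
  moreover have "n > 0" by (simp add: n)
  ultimately show ?thesis
    using difference_setI_corr[of ?f D n, OF f sum corr] by blast
qed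

end
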